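(* A function $\Psi:(0,\infty)\to[0,\infty)$ is completely monotone (on $(0,\infty)$) if and only if, for some (and hence all) positive sequence $(\epsilon_n)_{n\ge 0}$ such that $\epsilon_n\to 0$, the following two conditions hold for every $n$: (i) the function $\Psi$ has a holomorphic extension on $\{z\in\mathbb{C}:\mathrm{Re}(z)>0\}$ and remains bounded on $\{\mathrm{Re}(z)>\epsilon_n\}$; (ii) the sequence $(\Psi(\epsilon_n+k))_{k\ge 0}$ is completely monotone and minimal.
   Context: All functions are measurable. A function $\Psi:(0,\infty)\to[0,\infty)$ is completely monotone on $(0,\infty)$ if it is infinitely differentiable and $(-1)^n\Psi^{(n)}\ge 0$ for every integer $n\ge0$; equivalently, $\Psi(\lambda)=\int_{[0,\infty)}e^{-\lambda x}\,\nu(dx)$, $\lambda>0$, for a positive Radon measure $\nu$ on $[0,\infty)$. For a sequence $a=(a_k)_{k\ge 0}$ put $\Delta a(k)=a_{k+1}-a_k$ and let $\Delta^n$ be the iterates of $\Delta$. A non-negative sequence $a$ is completely monotone if $(-1)^n\Delta^n a(k)\ge 0$ for all integers $n,k\geq 0$. A completely monotone sequence $a$ is minimal if for every $\epsilon>0$ the sequence $(a_0-\epsilon,a_1,a_2,\dots)$ is not completely monotone. *)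

theory Defs
  imports "HOL-Analysis.Analysis"
begin

(* Functions on (0,oo) are total functions on the reals whose values outside (0,oo) are
   irrelevant; as (0,oo) is open, iterated derivatives at x > 0 depend only on the
   restriction to (0,oo). *)

definition completely_monotone :: "(real \<Rightarrow> real) \<Rightarrow> bool" where
  "completely_monotone \<Psi> \<longleftrightarrow>
     (\<forall>n. \<forall>x>0. (deriv ^^ n) \<Psi> field_differentiable at x) \<and>
     (\<forall>n. \<forall>x>0. 0 \<le> (-1) ^ n * (deriv ^^ n) \<Psi> x)"

definition fdiff :: "(nat \<Rightarrow> real) \<Rightarrow> nat \<Rightarrow> real" where
  "fdiff a k = a (Suc k) - a k"

definition completely_monotone_seq :: "(nat \<Rightarrow> real) \<Rightarrow> bool" where
  "completely_monotone_seq a \<longleftrightarrow>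
     (\<forall>k. 0 \<le> a k) \<and> (\<forall>n k. 0 \<le> (-1) ^ n * (fdiff ^^ n) a k)"

definition minimal_seq :: "(nat \<Rightarrow> real) \<Rightarrow> bool" where
  "minimal_seq a \<longleftrightarrow>
     completely_monotone_seq a \<and> (\<forall>\<epsilon>>0. \<not> completely_monotone_seq (a(0 := a 0 - \<epsilon>)))"

definition bounded_holomorphic_extension :: "(real \<Rightarrow> real) \<Rightarrow> real \<Rightarrow> bool" where
  "bounded_holomorphic_extension \<Psi> \<epsilon> \<longleftrightarrow>
     (\<exists>F. F holomorphic_on {z. 0 < Re z} \<and>
          (\<forall>x>0. F (complex_of_real x) = complex_of_real (\<Psi> x)) \<and>
          bounded (F ` {z. \<epsilon> < Re z}))"

end

theory Submission
  imports Defs "HOL-Complex_Analysis.Complex_Analysis"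
begin

text \<open>
  Suppose first that \<open>\<Psi>\<close> is completely monotone. Its Taylor series at \<open>b > 0\<close>, written in powers of
  \<open>b - x\<close>, has non-negative coefficients, and its remainder \<open>R\<^sub>K(x)\<close> is such that \<open>R\<^sub>K(x) / (b - x)\<^sup>K\<close>
  decreases in \<open>x\<close>. Comparing \<open>x\<close> with a smaller point \<open>y\<close> gives \<open>R\<^sub>K(x) \<le> ((b - x) / (b - y))\<^sup>K \<Psi>(y)\<close>
  (\<open>taylor_remainder_le\<close>), and both halves of the direct part follow from this single estimate.

  First, the series converges to \<open>\<Psi>\<close> on \<open>(0, b]\<close>, so it converges absolutely in the disc of centre \<open>b\<close>
  tangent to the imaginary axis, where it is dominated by the value of \<open>\<Psi>\<close> at \<open>b\<close> minus the distance to
  \<open>b\<close>. These discs increase to the half-plane \<open>Re z > 0\<close>, their sums are compatible, and letting \<open>b\<close> grow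
  bounds the extension by \<open>\<Psi>(\<epsilon>)\<close> on \<open>Re z > \<epsilon>\<close>.

  Secondly, the functions obtained by iterating \<open>f \<mapsto> f - f(\<cdot> + 1)\<close> on \<open>\<Psi>\<close> are completely monotone, so the
  samples form a completely monotone sequence. These functions decrease to a limit \<open>L\<close> with \<open>L(x) - L(x + 1) = L(x)\<close>;
  hence \<open>L = 0\<close> on \<open>(1, \<infinity>)\<close>. Expanding about a point beyond \<open>1\<close>, where all Taylor coefficients of the
  iterated differences tend to zero, the remainder estimate spreads this to \<open>L = 0\<close> on \<open>(0, \<infinity>)\<close>. At \<open>\<epsilon>\<close>
  this says that the alternating differences at index zero tend to zero, which is minimality.

  Conversely, let \<open>a\<^sub>k = \<Psi>(\<epsilon> + k)\<close> be completely monotone. The differences of \<open>a\<close> provide non-negative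
  weights \<open>w\<^sub>N(j)\<close> at the points \<open>j / N\<close> of total mass \<open>a\<^sub>0\<close>, whose moments converge to \<open>a\<close> (the discrete
  measures in Hausdorff's solution of the moment problem). The finite exponential sums
  \<open>G\<^sub>N(z) = \<Sum>\<^sub>j w\<^sub>N(j) (j / N)\<^bsup>z - \<epsilon>\<^esup>\<close> are completely monotone, bounded by \<open>a\<^sub>0\<close> on \<open>Re z > \<epsilon>\<close>, and at
  \<open>z = \<epsilon> + k\<close> with \<open>k \<ge> 1\<close> they tend to \<open>\<Psi>(\<epsilon> + k)\<close>. By Montel's theorem a subsequence converges locally
  uniformly. The limit and the bounded extension of \<open>\<Psi>\<close> agree at all \<open>\<epsilon> + k\<close> with \<open>k \<ge> 1\<close>, hence
  everywhere on \<open>Re z > \<epsilon>\<close>: a bounded holomorphic function on \<open>Re z > 0\<close> that vanishes at the positive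
  integers is zero (\<open>bounded_half_plane_zero\<close>), since it is dominated by Blaschke products that diverge to
  zero. Derivatives converge too, so \<open>\<Psi>\<close> has derivatives of alternating sign on \<open>(\<epsilon>, \<infinity>)\<close>. Points
  \<open>\<epsilon> = \<epsilon>\<^sub>n\<close> arbitrarily close to zero cover \<open>(0, \<infinity>)\<close>.
\<close>

section \<open>Taylor remainders of completely monotone functions\<close>

text \<open>
  A completely monotone function is handled together with all its derivatives, with the signs removed:
  \<open>d n\<close> stands for \<open>(-1)\<^sup>n \<Psi>\<^bsup>(n)\<^esup>\<close>. Differentiating and taking differences are then pointwise operations
  on the whole family, so that no iterated \<^const>\<open>deriv\<close> has to be recomputed.
\<close>

definition cm_jet :: "(nat \<Rightarrow> real \<Rightarrow> real) \<Rightarrow> bool" where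
  "cm_jet d \<longleftrightarrow>
     (\<forall>n. \<forall>x>0. 0 \<le> d n x \<and> (d n has_real_derivative - d (Suc n) x) (at x))"

lemma cm_jet_nonneg: "cm_jet d \<Longrightarrow> x > 0 \<Longrightarrow> 0 \<le> d n x"
  and cm_jet_deriv: "cm_jet d \<Longrightarrow> x > 0 \<Longrightarrow> (d n has_real_derivative - d (Suc n) x) (at x)"
  by (auto simp: cm_jet_def)

lemma cm_jet_of_completely_monotone:
  assumes "completely_monotone \<Psi>"
  shows "cm_jet (\<lambda>n x. (-1) ^ n * (deriv ^^ n) \<Psi> x)"
  unfolding cm_jet_def
proof (intro allI impI conjI)
  fix n and x :: real assume x: "x > 0"
  show "0 \<le> (-1) ^ n * (deriv ^^ n) \<Psi> x"
    using assms x by (auto simp: completely_monotone_def)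
  have "((deriv ^^ n) \<Psi> has_real_derivative (deriv ^^ Suc n) \<Psi> x) (at x)"
    using assms x by (auto simp: completely_monotone_def DERIV_deriv_iff_field_differentiable)
  then show "((\<lambda>x. (-1) ^ n * (deriv ^^ n) \<Psi> x) has_real_derivative
      - ((-1) ^ Suc n * (deriv ^^ Suc n) \<Psi> x)) (at x)"
    by (auto intro!: derivative_eq_intros)
qed

lemma cm_jet_Suc: "cm_jet d \<Longrightarrow> cm_jet (\<lambda>n. d (Suc n))"
  by (auto simp: cm_jet_def)

lemma cm_jet_antimono:
  assumes d: "cm_jet d" and "0 < x" "x \<le> y"
  shows "d n y \<le> d n x"
  using assms by (intro DERIV_nonpos_imp_nonincreasing[of x y "d n"])
    (auto intro!: exI cm_jet_deriv[OF d] cm_jet_nonneg[OF d])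

definition taylor_remainder :: "(nat \<Rightarrow> real \<Rightarrow> real) \<Rightarrow> nat \<Rightarrow> real \<Rightarrow> real \<Rightarrow> real" where
  "taylor_remainder d K b x = d 0 x - (\<Sum>k<K. d k b * (b - x) ^ k / fact k)"

lemma taylor_remainder_deriv:
  assumes d: "cm_jet d" and x: "x > 0"
  shows "(taylor_remainder d (Suc K) b has_real_derivative
           - taylor_remainder (\<lambda>n. d (Suc n)) K b x) (at x)"
proof -
  have "(taylor_remainder d (Suc K) b has_real_derivative
      - d (Suc 0) x - (\<Sum>k<Suc K. - (d k b * (real k * (b - x) ^ (k - 1)) / fact k))) (at x)"
    unfolding taylor_remainder_def
    by (intro DERIV_diff DERIV_sum cm_jet_deriv[OF d x]) (auto intro!: derivative_eq_intros)
  also have "- d (Suc 0) x - (\<Sum>k<Suc K. - (d k b * (real k * (b - x) ^ (k - 1)) / fact k))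
      = - taylor_remainder (\<lambda>n. d (Suc n)) K b x"
  proof -
    have "d (Suc k) b * (real (Suc k) * (b - x) ^ k) / fact (Suc k)
        = d (Suc k) b * (b - x) ^ k / fact k" for k
      by (simp del: of_nat_Suc)
    then show ?thesis
      by (simp add: taylor_remainder_def sum.lessThan_Suc_shift sum_negf
          del: sum.lessThan_Suc of_nat_Suc fact_Suc)
  qed
  finally show ?thesis .
qed

lemma taylor_remainder_at_centre: "taylor_remainder d (Suc K) b b = 0"
  by (simp add: taylor_remainder_def sum.lessThan_Suc_shift del: sum.lessThan_Suc)

lemma taylor_remainder_nonneg:
  assumes "cm_jet d" "0 < x" "x \<le> b"
  shows "0 \<le> taylor_remainder d K b x"
  using assms
proof (induction K arbitrary: d x)
  case 0
  then show ?case by (simp add: taylor_remainder_def cm_jet_nonneg)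
next
  case (Suc K)
  have "taylor_remainder d (Suc K) b b \<le> taylor_remainder d (Suc K) b x"
    using Suc.prems Suc.IH[OF cm_jet_Suc]
    by (intro DERIV_nonpos_imp_nonincreasing[OF \<open>x \<le> b\<close>])
      (auto intro!: exI taylor_remainder_deriv)
  then show ?case by (simp add: taylor_remainder_at_centre)
qed

text \<open>
  By induction on the order. The remainder \<open>R(t)\<close> of order \<open>K + 1\<close> is the integral over \<open>[t, b]\<close> of the order-\<open>K\<close>
  remainder \<open>S\<close> of the family shifted by one derivative. By the induction hypothesis \<open>S(s) \<le> S(t) ((b - s) / (b - t))\<^sup>K\<close> for
  \<open>s \<ge> t\<close>; integrating gives \<open>(K + 1) R(t) \<le> (b - t) S(t)\<close>, which is exactly the sign condition for the
  derivative of the ratio. The integration is replaced by the monotonicity of an auxiliary function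
  that vanishes at \<open>b\<close>.
\<close>

lemma taylor_remainder_ratio_antimono:
  assumes "cm_jet d" "0 < y" "y \<le> x" "x < b"
  shows "taylor_remainder d K b x / (b - x) ^ K \<le> taylor_remainder d K b y / (b - y) ^ K"
  using assms
proof (induction K arbitrary: d x y)
  case 0
  then show ?case by (simp add: taylor_remainder_def cm_jet_antimono)
next
  case (Suc K)
  note d = \<open>cm_jet d\<close>
  let ?R = "taylor_remainder d (Suc K) b"
  let ?S = "taylor_remainder (\<lambda>n. d (Suc n)) K b"
  have deriv_nonpos: "\<exists>D. ((\<lambda>t. ?R t / (b - t) ^ Suc K) has_real_derivative D) (at t) \<and> D \<le> 0"
    if t: "y \<le> t" "t \<le> x" for t
  proof -
    have t0: "0 < t" "t < b" using t Suc.prems by auto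
    define C where "C = ?S t / (b - t) ^ K"
    have St: "?S t = C * (b - t) ^ K" using t0 by (simp add: C_def)
    \<comment> \<open>In integral form: \<open>S\<close> is compared on \<open>[t, b]\<close> with its majorant \<open>C (b - s)\<^sup>K\<close>.\<close>
    let ?h = "\<lambda>s. C * (b - s) ^ Suc K / real (Suc K) - ?R s"
    have "?h b \<le> ?h t"
    proof (rule DERIV_nonpos_imp_nonincreasing[where f = ?h])
      fix s assume s: "t \<le> s" "s \<le> b"
      have "(?h has_real_derivative - C * (b - s) ^ K + ?S s) (at s)"
        using s t0
        by (auto intro!: derivative_eq_intros taylor_remainder_deriv[OF d]
            simp del: power_Suc of_nat_Suc)
      moreover have "?S s \<le> C * (b - s) ^ K"
      \<comment> \<open>At \<open>s = b\<close> the quotient in the induction hypothesis degenerates; for \<open>K = 0\<close> the majorant is the constant \<open>C\<close> even there.\<close>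
      proof (cases "s = b")
        case True
        show ?thesis
          using cm_jet_antimono[OF d \<open>0 < t\<close> s(1), of 1] St True
          by (cases K) (simp_all add: taylor_remainder_at_centre, simp add: taylor_remainder_def)
      next
        case False
        then have "?S s / (b - s) ^ K \<le> C"
          using Suc.IH[OF cm_jet_Suc[OF d] \<open>0 < t\<close>] s by (auto simp: C_def)
        then show ?thesis using False s by (simp add: pos_divide_le_eq C_def)
      qed
      ultimately show "\<exists>D. (?h has_real_derivative D) (at s) \<and> D \<le> 0" by force
    qed (use t0 in simp)
    then have le: "real (Suc K) * ?R t \<le> ?S t * (b - t)"
      using t0 by (simp add: taylor_remainder_at_centre St field_simps)
    have deriv: "((\<lambda>t. ?R t / (b - t) ^ Suc K) has_real_derivative
        (- ?S t * (b - t) ^ Suc K + ?R t * (real (Suc K) * (b - t) ^ K)) / ((b - t) ^ Suc K)\<^sup>2) (at t)"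
      using t0 by (auto intro!: derivative_eq_intros taylor_remainder_deriv[OF d]
          simp: power2_eq_square simp del: of_nat_Suc power_Suc)
    have "- ?S t * (b - t) ^ Suc K + ?R t * (real (Suc K) * (b - t) ^ K)
        = (b - t) ^ K * (real (Suc K) * ?R t - ?S t * (b - t))"
      by (simp add: algebra_simps)
    also have "\<dots> \<le> 0" using t0 le by (intro mult_nonneg_nonpos) auto
    finally have "(- ?S t * (b - t) ^ Suc K + ?R t * (real (Suc K) * (b - t) ^ K)) / ((b - t) ^ Suc K)\<^sup>2 \<le> 0"
      by (rule divide_nonpos_nonneg[OF _ zero_le_power2])
    with deriv show ?thesis by blast
  qed
  show ?case
    by (rule DERIV_nonpos_imp_nonincreasing[where f = "\<lambda>t. ?R t / (b - t) ^ Suc K", OF \<open>y \<le> x\<close> deriv_nonpos])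
qed

text \<open>
  The central estimate: the non-negative Taylor terms bound the remainder at \<open>y\<close> by the value at \<open>y\<close>, and
  the monotone ratio carries this bound to \<open>x\<close> with a geometric gain.
\<close>

lemma taylor_remainder_le:
  assumes d: "cm_jet d" and "0 < y" "y \<le> x" "x < b"
  shows "taylor_remainder d K b x \<le> ((b - x) / (b - y)) ^ K * d 0 y"
proof -
  have "taylor_remainder d K b x \<le> taylor_remainder d K b y * ((b - x) / (b - y)) ^ K"
    using taylor_remainder_ratio_antimono[OF assms, of K] assms
    by (simp add: power_divide field_simps)
  also have "\<dots> \<le> d 0 y * ((b - x) / (b - y)) ^ K"
  proof (intro mult_right_mono)
    have "0 \<le> (\<Sum>k<K. d k b * (b - y) ^ k / fact k)"
      using assms by (intro sum_nonneg divide_nonneg_pos mult_nonneg_nonneg cm_jet_nonneg[OF d]) auto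
    then show "taylor_remainder d K b y \<le> d 0 y" by (simp add: taylor_remainder_def)
  qed (use assms in auto)
  finally show ?thesis by (simp add: mult.commute)
qed

lemma taylor_sums:
  assumes d: "cm_jet d" and x: "0 < x" "x \<le> b"
  shows "(\<lambda>k. d k b * (b - x) ^ k / fact k) sums d 0 x"
proof (cases "x = b")
  case True
  then show ?thesis
    using powser_sums_zero[of "\<lambda>k. d k b / fact k"] by simp
next
  case False
  with x have xb: "x < b" by simp
  have "(\<lambda>K. ((b - x) / (b - x / 2)) ^ K * d 0 (x / 2)) \<longlonglongrightarrow> 0 * d 0 (x / 2)"
    using x xb by (intro tendsto_mult LIMSEQ_realpow_zero tendsto_const) auto
  then have lim: "(\<lambda>K. ((b - x) / (b - x / 2)) ^ K * d 0 (x / 2)) \<longlonglongrightarrow> 0" by simp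
  have "0 \<le> taylor_remainder d K b x" for K
    using taylor_remainder_nonneg[OF d] x by simp
  moreover have "taylor_remainder d K b x \<le> ((b - x) / (b - x / 2)) ^ K * d 0 (x / 2)" for K
    using taylor_remainder_le[OF d, of "x / 2" x b] x xb by simp
  ultimately have "(\<lambda>K. taylor_remainder d K b x) \<longlonglongrightarrow> 0"
    by (intro tendsto_sandwich[OF _ _ tendsto_const lim]) simp_all
  then have "(\<lambda>K. d 0 x - taylor_remainder d K b x) \<longlonglongrightarrow> d 0 x - 0"
    by (intro tendsto_diff tendsto_const)
  then show ?thesis by (simp add: sums_def taylor_remainder_def)
qed

section \<open>Holomorphic extension to the half-plane\<close>

definition taylor_extension :: "(nat \<Rightarrow> real \<Rightarrow> real) \<Rightarrow> real \<Rightarrow> complex \<Rightarrow> complex" where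
  "taylor_extension d b z = (\<Sum>k. of_real (d k b / fact k) * (of_real b - z) ^ k)"

text \<open>
  The coefficients are non-negative in powers of \<open>b - z\<close>, so the norms of the terms at \<open>z\<close> are the terms at
  the real point \<open>b - r\<close>, where \<open>r\<close> is the distance from \<open>z\<close> to \<open>b\<close>.
\<close>

lemma taylor_extension_sums_and_bound:
  assumes d: "cm_jet d" and z: "z \<in> ball (of_real b) b"
  shows "(\<lambda>k. of_real (d k b / fact k) * (of_real b - z) ^ k) sums taylor_extension d b z"
    and "norm (taylor_extension d b z) \<le> d 0 (b - norm (of_real b - z))"
proof -
  let ?r = "norm (of_real b - z)"
  have r: "?r < b" using z by (simp add: dist_norm)
  then have b: "b > 0" using norm_ge_zero[of "of_real b - z"] by linarith
  have S: "(\<lambda>k. d k b * ?r ^ k / fact k) sums d 0 (b - ?r)"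
    using taylor_sums[OF d, of "b - ?r" b] r by simp
  have eq: "norm (of_real (d k b / fact k) * (of_real b - z) ^ k) = d k b * ?r ^ k / fact k" for k
    using cm_jet_nonneg[OF d b, of k] by (simp add: norm_mult norm_power norm_divide)
  have N: "summable (\<lambda>k. norm (of_real (d k b / fact k) * (of_real b - z) ^ k))"
    unfolding eq by (rule sums_summable[OF S])
  show "(\<lambda>k. of_real (d k b / fact k) * (of_real b - z) ^ k) sums taylor_extension d b z"
    unfolding taylor_extension_def by (rule summable_sums[OF summable_norm_cancel[OF N]])
  show "norm (taylor_extension d b z) \<le> d 0 (b - ?r)"
    using summable_norm[OF N] unfolding taylor_extension_def eq sums_unique[OF S, symmetric] .
qed

lemma taylor_extension_holomorphic:
  assumes d: "cm_jet d"
  shows "taylor_extension d b holomorphic_on ball (of_real b) b"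
proof (rule power_series_holomorphic)
  fix w assume "w \<in> ball (complex_of_real b) b"
  note sums = taylor_extension_sums_and_bound(1)[OF d this]
  have "of_real b - w = (-1) * (w - of_real b)" by simp
  then have "(of_real b - w) ^ k = (-1) ^ k * (w - of_real b) ^ k" for k
    by (simp only: power_mult_distrib)
  with sums show "(\<lambda>k. (of_real (d k b / fact k) * (-1) ^ k) * (w - of_real b) ^ k)
          sums taylor_extension d b w"
    by (simp only: mult.assoc)
qed

lemma taylor_extension_real:
  assumes d: "cm_jet d" and x: "0 < x" "x \<le> b"
  shows "taylor_extension d b (of_real x) = of_real (d 0 x)"
proof -
  have "(\<lambda>k. complex_of_real (d k b * (b - x) ^ k / fact k)) sums of_real (d 0 x)"
    using taylor_sums[OF assms] by (rule sums_of_real)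
  moreover have "complex_of_real (d k b * (b - x) ^ k / fact k)
      = of_real (d k b / fact k) * (of_real b - of_real x) ^ k" for k
    by simp
  ultimately show ?thesis
    unfolding taylor_extension_def by (metis (no_types, lifting) ext sums_unique)
qed

lemma tangent_discs_nested:
  assumes "a \<le> b" shows "ball (complex_of_real a) a \<subseteq> ball (of_real b) b"
proof
  fix z assume "z \<in> ball (complex_of_real a) a"
  then have "dist (of_real a) z < a" by simp
  moreover have "dist (complex_of_real b) z \<le> dist (complex_of_real b) (of_real a) + dist (of_real a) z"
    by (rule dist_triangle)
  moreover have "dist (complex_of_real b) (of_real a) = b - a"
    using assms by (simp add: dist_of_real dist_real_def)
  ultimately show "z \<in> ball (of_real b) b" by simp
qed

lemma real_interval_islimpt:
  assumes "u < c" "c < v"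
  shows "complex_of_real c islimpt of_real ` {u<..<v}"
proof (rule islimpt_isCont_image)
  show "c islimpt {u<..<v}" using assms by (simp add: interior_limit_point interior_open)
qed (auto simp: eventually_at_filter)

text \<open>
  Both sums equal the given function on the interval \<open>(0, a)\<close>, which has limit points inside the smaller disc.
\<close>

lemma taylor_extension_cong:
  assumes d: "cm_jet d" and ab: "a \<le> b" and z: "z \<in> ball (of_real a) a"
  shows "taylor_extension d a z = taylor_extension d b z"
proof -
  have a: "a > 0" using z by (metis ball_empty empty_iff not_le)
  have "taylor_extension d a z - taylor_extension d b z = 0"
  proof (rule analytic_continuation[where
        f = "\<lambda>z. taylor_extension d a z - taylor_extension d b z"
        and S = "ball (of_real a) a" and U = "of_real ` {0<..<a}"
        and \<xi> = "of_real (a / 2)"])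
    show "(\<lambda>z. taylor_extension d a z - taylor_extension d b z) holomorphic_on ball (of_real a) a"
      by (intro holomorphic_on_diff taylor_extension_holomorphic[OF d]
          holomorphic_on_subset[OF taylor_extension_holomorphic[OF d] tangent_discs_nested[OF ab]])
    show "complex_of_real ` {0<..<a} \<subseteq> ball (of_real a) a" "complex_of_real (a / 2) \<in> ball (of_real a) a"
      using a by (auto simp: dist_of_real dist_real_def simp del: of_real_divide)
    show "complex_of_real (a / 2) islimpt of_real ` {0<..<a}"
      using a by (intro real_interval_islimpt) auto
    show "taylor_extension d a w - taylor_extension d b w = 0" if "w \<in> of_real ` {0<..<a}" for w
      using that ab by (auto simp: taylor_extension_real[OF d])
  qed (use z in auto)
  then show ?thesis by simp
qed


text \<open>
  As \<open>N\<close> tends to infinity, \<open>N\<close> minus the distance from \<open>z\<close> to \<open>N\<close> increases to \<open>Re z\<close>. This shows that the tangent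
  discs cover the half-plane, and it yields a bound that depends on the real part alone.
\<close>

lemma tangent_discs_exhaust:
  assumes "0 \<le> e" "e < Re z"
  obtains N :: nat where "norm (of_real (real N) - z) \<le> real N - e"
proof -
  define u where "u = Re z - e"
  \<comment> \<open>Squaring the claim and cancelling \<open>N\<^sup>2\<close> leaves a linear condition on \<open>N\<close>, met by this choice.\<close>
  obtain N :: nat where N: "real N \<ge> ((Re z)\<^sup>2 + (Im z)\<^sup>2) / (2 * u) + e"
    using real_arch_simple by blast
  have u: "u > 0" using assms by (simp add: u_def)
  have N': "(Re z)\<^sup>2 + (Im z)\<^sup>2 \<le> (real N - e) * (2 * u)"
    using N u by (simp add: field_simps)
  have "0 \<le> ((Re z)\<^sup>2 + (Im z)\<^sup>2) / (2 * u)" using u by simp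
  then have Ne: "real N \<ge> e" using N by linarith
  have "(norm (of_real (real N) - z))\<^sup>2 = (real N - Re z)\<^sup>2 + (Im z)\<^sup>2"
    by (simp add: cmod_power2)
  also have "\<dots> \<le> (real N - e)\<^sup>2"
  proof -
    have Nu: "(real N - e) * (2 * u) \<le> real N * (2 * u)"
      using u assms by (intro mult_right_mono) auto
    have "(real N - Re z)\<^sup>2 + (Im z)\<^sup>2 - (real N - e)\<^sup>2
       = (Re z)\<^sup>2 + (Im z)\<^sup>2 - real N * (2 * u) - e\<^sup>2"
      by (simp add: u_def power2_eq_square algebra_simps)
    then show ?thesis using N' Nu zero_le_power2[of e] by linarith
  qed
  finally have "norm (of_real (real N) - z) \<le> real N - e"
    by (rule power2_le_imp_le) (use Ne in simp)
  then show thesis by (rule that)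
qed

text \<open>
  The extension is glued from the compatible sums on the discs tangent at the origin with integer
  centres. Evaluating at \<open>z\<close> in a disc so large that \<open>tangent_discs_exhaust\<close> applies turns the bound on
  that disc into the value at \<open>\<epsilon>\<close>.
\<close>

lemma cm_jet_bounded_holomorphic_extension:
  assumes d: "cm_jet d" and \<epsilon>: "\<epsilon> > 0"
  shows "bounded_holomorphic_extension (d 0) \<epsilon>"
proof -
  define B where "B n = ball (complex_of_real (real n)) (real n)" for n :: nat
  define N where "N z = (LEAST n. z \<in> B n)" for z
  define F where "F z = taylor_extension d (real (N z)) z" for z
  have exB: "\<exists>n. z \<in> B n" if z: "0 < Re z" for z
  proof -
    obtain n :: nat where n: "norm (of_real (real n) - z) \<le> real n - Re z / 2"
      by (rule tangent_discs_exhaust[of "Re z / 2" z]) (use z in auto)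
    then show ?thesis using z by (intro exI[of _ n]) (simp add: B_def dist_norm)
  qed
  have F: "F z = taylor_extension d (real n) z" if z: "z \<in> B n" for z n
  proof -
    have "z \<in> B (N z)" unfolding N_def using z by (rule LeastI)
    moreover have "N z \<le> n" unfolding N_def using z by (rule Least_le)
    ultimately show ?thesis
      unfolding F_def by (intro taylor_extension_cong[OF d]) (auto simp: B_def)
  qed
  have "F holomorphic_on (\<Union>n. B n)"
  proof (rule holomorphic_on_UN_open)
    fix n
    have "taylor_extension d (real n) holomorphic_on B n"
      unfolding B_def by (rule taylor_extension_holomorphic[OF d])
    then show "F holomorphic_on B n"
      by (rule holomorphic_transform) (simp add: F)
  qed (simp add: B_def)
  then have hol: "F holomorphic_on {z. 0 < Re z}"
    by (rule holomorphic_on_subset) (use exB in auto)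
  have real: "F (of_real x) = of_real (d 0 x)" if x: "x > 0" for x
  proof -
    obtain n where n: "x < real n" using reals_Archimedean2 by blast
    have "complex_of_real x \<in> B n"
      using n x unfolding B_def mem_ball dist_of_real dist_real_def by simp
    then show ?thesis using n x by (simp add: F taylor_extension_real[OF d])
  qed
  have "norm (F z) \<le> d 0 \<epsilon>" if z: "\<epsilon> < Re z" for z
  proof -
    obtain n :: nat where n: "norm (of_real (real n) - z) \<le> real n - \<epsilon>"
      by (rule tangent_discs_exhaust[of \<epsilon> z]) (use z \<epsilon> in auto)
    then have zB: "z \<in> B n" using \<epsilon> by (simp add: B_def dist_norm)
    have "norm (F z) \<le> d 0 (real n - norm (of_real (real n) - z))"
      using taylor_extension_sums_and_bound(2)[OF d zB[unfolded B_def]] zB by (simp add: F)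
    also have "\<dots> \<le> d 0 \<epsilon>" using n \<epsilon> by (intro cm_jet_antimono[OF d]) auto
    finally show ?thesis .
  qed
  then have "bounded (F ` {z. \<epsilon> < Re z})" by (auto simp: bounded_iff)
  with hol real show ?thesis unfolding bounded_holomorphic_extension_def
    by (intro exI[of _ F] conjI allI impI)
qed

section \<open>Finite differences and minimality\<close>

definition diff_jet :: "(nat \<Rightarrow> real \<Rightarrow> real) \<Rightarrow> nat \<Rightarrow> real \<Rightarrow> real" where
  "diff_jet d k x = d k x - d k (x + 1)"

lemma cm_jet_diff_jet: "cm_jet d \<Longrightarrow> cm_jet (diff_jet d)"
  unfolding cm_jet_def
proof (intro allI impI conjI)
  fix n and x :: real
  assume "\<forall>n. \<forall>x>0. 0 \<le> d n x \<and> (d n has_real_derivative - d (Suc n) x) (at x)"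
    and x: "x > 0"
  then have d: "cm_jet d" by (simp add: cm_jet_def)
  show "0 \<le> diff_jet d n x" using cm_jet_antimono[OF d x, of "x + 1" n] by (simp add: diff_jet_def)
  have "((\<lambda>x. d n (x + 1)) has_real_derivative - d (Suc n) (x + 1)) (at x)"
    using cm_jet_deriv[OF d, of "x + 1" n] x by (simp add: DERIV_shift)
  then show "(diff_jet d n has_real_derivative - diff_jet d (Suc n) x) (at x)"
    unfolding diff_jet_def using cm_jet_deriv[OF d x, of n]
    by (auto intro!: derivative_eq_intros)
qed

lemma cm_jet_iterated_diff_jet: "cm_jet d \<Longrightarrow> cm_jet ((diff_jet ^^ n) d)"
  by (induction n) (auto intro: cm_jet_diff_jet)

lemma fdiff_iterated_jet:
  "(-1) ^ n * (fdiff ^^ n) (\<lambda>k. d 0 (x + real k)) k = (diff_jet ^^ n) d 0 (x + real k)"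
proof (induction n arbitrary: k)
  case (Suc n)
  show ?case using Suc.IH[of k] Suc.IH[of "Suc k"]
    by (simp add: fdiff_def diff_jet_def algebra_simps)
qed simp

lemma completely_monotone_seq_of_jet:
  assumes "cm_jet d" "x > 0"
  shows "completely_monotone_seq (\<lambda>k. d 0 (x + real k))"
  unfolding completely_monotone_seq_def
  using cm_jet_nonneg[OF assms(1)] cm_jet_nonneg[OF cm_jet_iterated_diff_jet[OF assms(1)]] assms(2)
  by (simp add: fdiff_iterated_jet)

lemma iterated_diff_jet_limit:
  assumes d: "cm_jet d" and x: "x > 0"
  obtains L where "(\<lambda>n. (diff_jet ^^ n) d k x) \<longlonglongrightarrow> L" "0 \<le> L"
proof -
  have "(diff_jet ^^ Suc n) d k x \<le> (diff_jet ^^ n) d k x" for n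
    using cm_jet_nonneg[OF cm_jet_iterated_diff_jet[OF d], of "x + 1" n k] x by (simp add: diff_jet_def)
  then have "decseq (\<lambda>n. (diff_jet ^^ n) d k x)" by (rule decseq_SucI)
  moreover have nn: "0 \<le> (diff_jet ^^ n) d k x" for n
    using cm_jet_nonneg[OF cm_jet_iterated_diff_jet[OF d] x] .
  ultimately obtain L where "(\<lambda>n. (diff_jet ^^ n) d k x) \<longlonglongrightarrow> L"
    using decseq_convergent[of "\<lambda>n. (diff_jet ^^ n) d k x" 0] by blast
  moreover from this nn have "0 \<le> L" by (intro LIMSEQ_le_const) auto
  ultimately show thesis by (rule that)
qed

text \<open>
  The value at \<open>x + 1\<close> is the drop of the \<open>n\<close>-th iterate at \<open>x\<close> when passing to the next one, and the iterates at \<open>x\<close> converge.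
\<close>

lemma iterated_diff_jet_tendsto_0_beyond_1:
  assumes d: "cm_jet d" and x: "x > 0"
  shows "(\<lambda>n. (diff_jet ^^ n) d k (x + 1)) \<longlonglongrightarrow> 0"
proof -
  obtain L where L: "(\<lambda>n. (diff_jet ^^ n) d k x) \<longlonglongrightarrow> L"
    using iterated_diff_jet_limit[OF d x] .
  have "(\<lambda>n. (diff_jet ^^ n) d k x - (diff_jet ^^ Suc n) d k x) \<longlonglongrightarrow> L - L"
    using L LIMSEQ_Suc[OF L] by (rule tendsto_diff)
  then show ?thesis by (simp add: diff_jet_def)
qed

lemma iterated_diff_jet_le:
  assumes d: "cm_jet d" and x: "x > 0"
  shows "(diff_jet ^^ n) d k x \<le> d k x"
proof (induction n)
  case (Suc n)
  have "(diff_jet ^^ Suc n) d k x \<le> (diff_jet ^^ n) d k x"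
    using cm_jet_nonneg[OF cm_jet_iterated_diff_jet[OF d], of "x + 1" n k] x by (simp add: diff_jet_def)
  with Suc show ?case by simp
qed simp

text \<open>
  Taylor expansion about \<open>b = x + 2\<close> reaches the points below \<open>1\<close>: the finitely many Taylor coefficients at
  \<open>b\<close> tend to zero with \<open>n\<close>, while the remainder is small uniformly in \<open>n\<close> because the iterated differences
  at \<open>x / 2\<close> never exceed the original function.
\<close>

lemma iterated_diff_jet_tendsto_0:
  assumes d: "cm_jet d" and x: "x > 0"
  shows "(\<lambda>n. (diff_jet ^^ n) d 0 x) \<longlonglongrightarrow> 0"
proof -
  obtain L where L: "(\<lambda>n. (diff_jet ^^ n) d 0 x) \<longlonglongrightarrow> L" "0 \<le> L"
    using iterated_diff_jet_limit[OF d x] .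
  define b where "b = x + 2"
  define q where "q = (b - x) / (b - x / 2)"
  have q: "0 \<le> q" "q < 1" using x by (auto simp: q_def b_def)
  have "L \<le> q ^ K * d 0 (x / 2)" for K
  proof (rule LIMSEQ_le)
    show "(\<lambda>n. (diff_jet ^^ n) d 0 x) \<longlonglongrightarrow> L" by fact
    have "(\<lambda>n. (diff_jet ^^ n) d k b) \<longlonglongrightarrow> 0" for k
      using iterated_diff_jet_tendsto_0_beyond_1[OF d, of "x + 1" k] x by (simp add: b_def add.assoc)
    then have "(\<lambda>n. (\<Sum>k<K. (diff_jet ^^ n) d k b * (b - x) ^ k / fact k) + q ^ K * d 0 (x / 2))
        \<longlonglongrightarrow> (\<Sum>k<K. 0 * (b - x) ^ k / fact k) + q ^ K * d 0 (x / 2)"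
      by (intro tendsto_intros) auto
    then show "(\<lambda>n. (\<Sum>k<K. (diff_jet ^^ n) d k b * (b - x) ^ k / fact k) + q ^ K * d 0 (x / 2))
        \<longlonglongrightarrow> q ^ K * d 0 (x / 2)" by simp
    have "(diff_jet ^^ n) d 0 x
        \<le> (\<Sum>k<K. (diff_jet ^^ n) d k b * (b - x) ^ k / fact k) + q ^ K * d 0 (x / 2)" for n
    proof -
      have "taylor_remainder ((diff_jet ^^ n) d) K b x \<le> q ^ K * (diff_jet ^^ n) d 0 (x / 2)"
        unfolding q_def using x
        by (intro taylor_remainder_le cm_jet_iterated_diff_jet[OF d]) (auto simp: b_def)
      also have "\<dots> \<le> q ^ K * d 0 (x / 2)"
        using q x by (intro mult_left_mono iterated_diff_jet_le[OF d]) auto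
      finally show ?thesis by (simp add: taylor_remainder_def)
    qed
    then show "\<exists>N. \<forall>n\<ge>N. (diff_jet ^^ n) d 0 x
        \<le> (\<Sum>k<K. (diff_jet ^^ n) d k b * (b - x) ^ k / fact k) + q ^ K * d 0 (x / 2)"
      by blast
  qed
  moreover have "(\<lambda>K. q ^ K * d 0 (x / 2)) \<longlonglongrightarrow> 0 * d 0 (x / 2)"
    using q by (intro tendsto_mult LIMSEQ_realpow_zero tendsto_const)
  ultimately have "L \<le> 0" by (intro LIMSEQ_le_const[where X = "\<lambda>K. q ^ K * d 0 (x / 2)"]) auto
  with L show ?thesis by simp
qed

lemma fdiff_iterated_lower_first:
  "(fdiff ^^ n) (a(0 := a 0 - \<delta>)) k = (fdiff ^^ n) a k - (if k = 0 then (-1) ^ n * \<delta> else 0)"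
  by (induction n arbitrary: k) (auto simp: fdiff_def)

text \<open>
  Lowering the first entry by \<open>\<delta>\<close> lowers every alternating difference at index zero by exactly \<open>\<delta>\<close>, so
  these differences cannot remain non-negative once they fall below \<open>\<delta>\<close>.
\<close>

lemma minimal_seqI:
  assumes a: "completely_monotone_seq a" and lim: "(\<lambda>n. (-1) ^ n * (fdiff ^^ n) a 0) \<longlonglongrightarrow> 0"
  shows "minimal_seq a"
  unfolding minimal_seq_def
proof (intro conjI allI impI notI a)
  fix \<delta> :: real assume \<delta>: "\<delta> > 0" and cm: "completely_monotone_seq (a(0 := a 0 - \<delta>))"
  have "\<forall>\<^sub>F n in sequentially. (-1) ^ n * (fdiff ^^ n) a 0 < \<delta>"
    using lim \<delta> by (rule order_tendstoD)
  then obtain n where "(-1) ^ n * (fdiff ^^ n) a 0 < \<delta>"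
    by (auto simp: eventually_sequentially)
  moreover have "0 \<le> (-1) ^ n * (fdiff ^^ n) (a(0 := a 0 - \<delta>)) 0"
    using cm by (simp add: completely_monotone_seq_def)
  moreover have "(-1) ^ n * (fdiff ^^ n) (a(0 := a 0 - \<delta>)) 0
      = (-1) ^ n * (fdiff ^^ n) a 0 - ((-1) ^ n * (-1) ^ n) * \<delta>"
    unfolding fdiff_iterated_lower_first by (simp only: if_True refl right_diff_distrib mult.assoc)
  ultimately show False unfolding minus_one_mult_self by linarith
qed

lemma minimal_seq_of_jet:
  assumes d: "cm_jet d" and x: "x > 0"
  shows "minimal_seq (\<lambda>k. d 0 (x + real k))"
  using iterated_diff_jet_tendsto_0[OF assms]
  by (intro minimal_seqI completely_monotone_seq_of_jet assms)
    (simp only: fdiff_iterated_jet of_nat_0 add_0_right)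

section \<open>Bounded functions on a half-plane vanishing at the positive integers\<close>

text \<open>
  This is the Schwarz lemma after the Moebius map \<open>w \<mapsto> p (1 + w) / (1 - w)\<close> from the unit disc onto the
  half-plane, which sends \<open>0\<close> to \<open>p\<close> and has inverse \<open>z \<mapsto> (z - p) / (z + p)\<close>. The bound \<open>M\<close> is
  relaxed to \<open>M + e\<close> because the Schwarz lemma asks for values strictly inside the disc.
\<close>

lemma half_plane_Schwarz:
  assumes holf: "f holomorphic_on {z. 0 < Re z}"
    and bound: "\<And>z. 0 < Re z \<Longrightarrow> norm (f z) \<le> M"
    and p: "p > 0" and fp: "f (of_real p) = 0" and z: "0 < Re z"
  shows "norm (f z) * norm (z + of_real p) \<le> M * norm (z - of_real p)"
proof -
  define \<phi> where "\<phi> w = of_real p * ((1 + w) / (1 - w))" for w :: complex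
  have \<phi>: "0 < Re (\<phi> w)" if "norm w < 1" for w
  proof -
    have "(norm w)\<^sup>2 < 1" using that by (simp add: power_less_one_iff)
    then have "0 < Re ((1 + w) / (1 - w))"
      unfolding Re_complex_div_gt_0 cmod_power2 by (simp add: power2_eq_square algebra_simps)
    then show ?thesis using p by (simp add: \<phi>_def del: times_divide_eq_right)
  qed
  have hol\<phi>: "\<phi> holomorphic_on ball 0 1"
    unfolding \<phi>_def by (intro holomorphic_intros) auto
  define w where "w = (z - of_real p) / (z + of_real p)"
  have zp: "z + of_real p \<noteq> 0" using z p by (auto simp: complex_eq_iff)
  have "(norm (z - of_real p))\<^sup>2 < (norm (z + of_real p))\<^sup>2"
    using z p unfolding cmod_power2 by (simp add: power2_eq_square algebra_simps)
  then have lt: "norm (z - of_real p) < norm (z + of_real p)" by (rule power2_less_imp_less) simp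
  then have w: "norm w < 1" by (simp add: w_def norm_divide divide_less_eq)
  have \<phi>w: "\<phi> w = z"
  proof -
    have "1 + w = 2 * z / (z + of_real p)" "1 - w = 2 * of_real p / (z + of_real p)"
      using zp by (auto simp: w_def field_simps)
    then show ?thesis using zp p by (simp add: \<phi>_def)
  qed
  have M: "M \<ge> 0" using bound[OF z] norm_ge_zero order_trans by blast
  have "norm (f z) \<le> M * norm w + e" if e: "e > 0" for e
  proof -
    define g where "g v = f (\<phi> v) / of_real (M + e)" for v
    have "norm (g w) \<le> norm w"
    proof (rule Schwarz_Lemma(1))
      have "(f \<circ> \<phi>) holomorphic_on ball 0 1"
        using \<phi> by (intro holomorphic_on_compose_gen[OF hol\<phi> holf]) auto
      then show "g holomorphic_on ball 0 1"
        unfolding g_def o_def using M e by (intro holomorphic_intros) auto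
      show "g 0 = 0" by (simp add: g_def \<phi>_def fp)
      show "norm (g v) < 1" if "norm v < 1" for v
        using bound[OF \<phi>[OF that]] M e by (simp add: g_def norm_divide del: of_real_add)
    qed (rule w)
    then have "norm (f z) \<le> norm w * (M + e)"
      using M e by (simp add: g_def \<phi>w norm_divide pos_divide_le_eq del: of_real_add)
    also have "\<dots> \<le> M * norm w + e" using w e by (simp add: algebra_simps)
    finally show ?thesis .
  qed
  then have "norm (f z) \<le> M * norm w" by (rule field_le_epsilon)
  then show ?thesis using zp by (simp add: w_def norm_divide pos_le_divide_eq)
qed

text \<open>
  Dividing out one zero keeps the same bound: away from \<open>p\<close> this is \<open>half_plane_Schwarz\<close>, and at the
  removable singularity \<open>p\<close> it follows by continuity.
\<close>

lemma half_plane_factor: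
  assumes holf: "f holomorphic_on {z. 0 < Re z}"
    and bound: "\<And>z. 0 < Re z \<Longrightarrow> norm (f z) \<le> M"
    and p: "p > 0" and fp: "f (of_real p) = 0"
  obtains q where "q holomorphic_on {z. 0 < Re z}" "\<And>z. 0 < Re z \<Longrightarrow> norm (q z) \<le> M"
    "\<And>z. 0 < Re z \<Longrightarrow> f z = q z * ((z - of_real p) / (z + of_real p))"
proof
  let ?H = "{z. 0 < Re z}"
  have open_H: "open ?H" by (rule open_halfspace_Re_gt)
  define h where "h z = (if z = of_real p then deriv f (of_real p)
      else (f z - f (of_real p)) / (z - of_real p))" for z
  define q where "q z = (z + of_real p) * h z" for z
  have "h holomorphic_on ?H"
    unfolding h_def by (rule pole_lemma[OF holf]) (use p open_H in \<open>simp add: interior_open\<close>)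
  then show holq: "q holomorphic_on ?H"
    unfolding q_def by (intro holomorphic_intros)
  have le: "norm (q z) \<le> M" if "0 < Re z" "z \<noteq> of_real p" for z
    using half_plane_Schwarz[OF assms that(1)] that(2)
    by (simp add: q_def h_def fp norm_mult norm_divide pos_divide_le_eq mult.commute)
  show "norm (q z) \<le> M" if z: "0 < Re z" for z
  proof (cases "z = of_real p")
    case True
    have "continuous_on ?H q" using holq by (rule holomorphic_on_imp_continuous_on)
    then have "isCont q z" using z open_H by (simp add: continuous_on_eq_continuous_at)
    then have "(q \<longlongrightarrow> q z) (at z)" by (simp add: isCont_def)
    moreover have "eventually (\<lambda>y. norm (q y) \<le> M) (at z)"
      using eventually_at_in_open[OF open_H, of z] z
      by (auto elim!: eventually_mono simp: True intro!: le)
    ultimately show ?thesis by (intro Lim_norm_ubound[where net = "at z" and f = q]) auto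
  qed (use le z in auto)
  show "f z = q z * ((z - of_real p) / (z + of_real p))" if "0 < Re z" for z
  proof -
    have "z + of_real p \<noteq> 0" using that p by (auto simp: complex_eq_iff)
    then show ?thesis by (cases "z = of_real p") (auto simp: q_def h_def fp)
  qed
qed

lemma half_plane_Blaschke_factor:
  assumes "f holomorphic_on {z. 0 < Re z}"
    and "\<And>z. 0 < Re z \<Longrightarrow> norm (f z) \<le> M"
    and zeros: "\<And>k::nat. k \<ge> 1 \<Longrightarrow> f (of_nat k) = 0"
  shows "\<exists>q. q holomorphic_on {z. 0 < Re z} \<and> (\<forall>z. 0 < Re z \<longrightarrow> norm (q z) \<le> M) \<and>
           (\<forall>z. 0 < Re z \<longrightarrow> f z = q z * (\<Prod>k=1..n. (z - of_nat k) / (z + of_nat k)))"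
proof (induction n)
  case 0
  then show ?case using assms by (intro exI[of _ f]) auto
next
  case (Suc n)
  then obtain q where holq: "q holomorphic_on {z. 0 < Re z}"
    and qM: "\<And>z. 0 < Re z \<Longrightarrow> norm (q z) \<le> M"
    and f: "\<And>z. 0 < Re z \<Longrightarrow> f z = q z * (\<Prod>k=1..n. (z - of_nat k) / (z + of_nat k))" by blast
  have ne: "(of_nat (Suc n) - of_nat k) / (of_nat (Suc n) + of_nat k) \<noteq> (0 :: complex)"
    if "k \<in> {1..n}" for k
  proof -
    have "of_nat (Suc n) \<noteq> (of_nat k :: complex)" using that by (simp only: of_nat_eq_iff) auto
    moreover have "of_nat (Suc n + k) \<noteq> (0 :: complex)" by (simp only: of_nat_eq_0_iff)
    ultimately show ?thesis by (simp only: of_nat_add) simp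
  qed
  have "q (of_nat (Suc n)) * (\<Prod>k=1..n. (of_nat (Suc n) - of_nat k) / (of_nat (Suc n) + of_nat k)) = 0"
    using f[of "of_nat (Suc n)"] zeros[of "Suc n"] by simp
  moreover have "(\<Prod>k=1..n. (of_nat (Suc n) - of_nat k) / (of_nat (Suc n) + of_nat k)) \<noteq> (0 :: complex)"
    using ne by (simp only: prod_zero_iff finite_atLeastAtMost) blast
  ultimately have "q (of_real (real (Suc n))) = 0" by (simp only: mult_eq_0_iff of_real_of_nat_eq) blast
  then obtain r where r: "r holomorphic_on {z. 0 < Re z}" "\<And>z. 0 < Re z \<Longrightarrow> norm (r z) \<le> M"
    "\<And>z. 0 < Re z \<Longrightarrow> q z = r z * ((z - of_real (real (Suc n))) / (z + of_real (real (Suc n))))"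
    using half_plane_factor[OF holq qM, of "real (Suc n)"] by auto
  have "f z = r z * (\<Prod>k=1..Suc n. (z - of_nat k) / (z + of_nat k))" if "0 < Re z" for z
    using f[OF that] r(3)[OF that] by (simp add: mult_ac)
  with r show ?case by blast
qed

text \<open>
  The factor with index \<open>k\<close> is at most \<open>1 - x / k \<le> exp (- x / k)\<close>, and the harmonic series diverges.
\<close>

lemma Blaschke_product_tendsto_0:
  assumes x: "0 < x" "x < 1"
  shows "(\<lambda>n. \<Prod>k=1..n. (real k - x) / (real k + x)) \<longlonglongrightarrow> 0"
proof (rule tendsto_sandwich[OF always_eventually always_eventually tendsto_const])
  have pos: "0 \<le> (real k - x) / (real k + x)" if "k \<in> {1..n}" for k n
    using that x by auto
  then show "\<forall>n. 0 \<le> (\<Prod>k=1..n. (real k - x) / (real k + x))" by (blast intro: prod_nonneg)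
  have le: "(real k - x) / (real k + x) \<le> exp (- x * inverse (real k))" if "k \<in> {1..n}" for k n
  proof -
    have k: "real k \<ge> 1" using that by simp
    have "(real k - x) / (real k + x) \<le> 1 + - x * inverse (real k)"
    proof -
      have "(real k - x) / (real k + x) = 1 - 2 * x / (real k + x)"
        using k x by (simp add: field_simps)
      moreover have "x / real k \<le> 2 * x / (real k + x)"
      proof -
        have "x * x \<le> real k * x" using k x by (intro mult_right_mono) auto
        then show ?thesis using k x by (simp add: field_simps)
      qed
      ultimately show ?thesis by (simp add: divide_inverse)
    qed
    also have "\<dots> \<le> exp (- x * inverse (real k))" by (rule exp_ge_add_one_self)
    finally show ?thesis .
  qed
  show "\<forall>n. (\<Prod>k=1..n. (real k - x) / (real k + x)) \<le> exp (- x * harm n)"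
  proof
    fix n
    have "(\<Prod>k=1..n. (real k - x) / (real k + x)) \<le> (\<Prod>k=1..n. exp (- x * inverse (real k)))"
      using le pos by (intro prod_mono conjI) auto
    also have "\<dots> = exp (- x * harm n)"
      by (simp add: exp_sum[symmetric] harm_def sum_distrib_left sum_negf)
    finally show "(\<Prod>k=1..n. (real k - x) / (real k + x)) \<le> exp (- x * harm n)" .
  qed
  have "filterlim (\<lambda>n. - x * harm n) at_bot sequentially"
    using x by (intro filterlim_tendsto_neg_mult_at_bot[OF tendsto_const _ harm_at_top]) auto
  then show "(\<lambda>n. exp (- x * harm n)) \<longlonglongrightarrow> 0"
    by (rule filterlim_compose[OF exp_at_bot])
qed

text \<open>
  The bound \<open>M\<close> survives the division by any number of the zeros, so \<open>f\<close> is at most \<open>M\<close> times the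
  Blaschke product. It is enough to let the product tend to zero on \<open>(0, 1)\<close>, where no factor changes sign.
\<close>

lemma bounded_half_plane_zero:
  assumes holf: "f holomorphic_on {z. 0 < Re z}"
    and bound: "\<And>z. 0 < Re z \<Longrightarrow> norm (f z) \<le> M"
    and zeros: "\<And>k::nat. k \<ge> 1 \<Longrightarrow> f (of_nat k) = 0" and z: "0 < Re z"
  shows "f z = 0"
proof (rule analytic_continuation[OF holf, where U = "of_real ` {0<..<1}" and \<xi> = "of_real (1 / 2)"])
  show "connected {z. 0 < Re z}" by (intro convex_connected convex_halfspace_Re_gt)
  show "complex_of_real (1 / 2) islimpt of_real ` {0<..<1}" by (rule real_interval_islimpt) auto
  fix w :: complex assume "w \<in> of_real ` {0<..<1}"
  then obtain x where w: "w = of_real x" and x: "0 < x" "x < 1" by auto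
  have "norm (f w) \<le> M * (\<Prod>k=1..n. (real k - x) / (real k + x))" for n
  proof -
    obtain q where qM: "\<And>z. 0 < Re z \<Longrightarrow> norm (q z) \<le> M"
      and f: "\<And>z. 0 < Re z \<Longrightarrow> f z = q z * (\<Prod>k=1..n. (z - of_nat k) / (z + of_nat k))"
      using half_plane_Blaschke_factor[OF holf bound zeros] by blast
    have "norm ((w - of_nat k) / (w + of_nat k)) = (real k - x) / (real k + x)" if "k \<in> {1..n}" for k
    proof -
      have "w - of_nat k = of_real (x - real k)" "w + of_nat k = of_real (x + real k)"
        by (simp_all add: w)
      then show ?thesis using that x by (simp only: norm_divide norm_of_real) auto
    qed
    then have "norm (f w) = norm (q w) * (\<Prod>k=1..n. (real k - x) / (real k + x))"
      using f[of w] x by (simp add: w norm_mult prod_norm[symmetric])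
    also have "\<dots> \<le> M * (\<Prod>k=1..n. (real k - x) / (real k + x))"
      using qM[of w] x by (intro mult_right_mono prod_nonneg) (auto simp: w)
    finally show ?thesis .
  qed
  moreover have "(\<lambda>n. M * (\<Prod>k=1..n. (real k - x) / (real k + x))) \<longlonglongrightarrow> M * 0"
    by (intro tendsto_mult tendsto_const Blaschke_product_tendsto_0 x)
  ultimately have "norm (f w) \<le> 0" by (intro LIMSEQ_le_const[where a = "norm (f w)"]) auto
  then show "f w = 0" by simp
qed (use z in \<open>auto simp: open_halfspace_Re_gt\<close>)

section \<open>Hausdorff moments of a completely monotone sequence\<close>

text \<open>
  If \<open>a\<close> is the moment sequence of a measure \<open>\<mu>\<close> on \<open>[0, 1]\<close>, this is the integral of the Bernstein polynomial
  \<open>(N choose j) u\<^sup>j (1 - u)\<^bsup>N - j\<^esup>\<close> against \<open>\<mu>\<close>; placed at the point \<open>j / N\<close>, these weights approximate \<open>\<mu>\<close>.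
\<close>

definition hausdorff_weight :: "(nat \<Rightarrow> real) \<Rightarrow> nat \<Rightarrow> nat \<Rightarrow> real" where
  "hausdorff_weight a N j = real (N choose j) * ((-1) ^ (N - j) * (fdiff ^^ (N - j)) a j)"

lemma hausdorff_weight_nonneg:
  "completely_monotone_seq a \<Longrightarrow> 0 \<le> hausdorff_weight a N j"
  by (simp add: hausdorff_weight_def completely_monotone_seq_def)

lemma sum_choose_Suc:
  "(\<Sum>i\<le>Suc M. real (Suc M choose i) * g i) = (\<Sum>i\<le>M. real (M choose i) * (g i + g (Suc i)))"
proof -
  have "(\<Sum>i\<le>M. real (M choose i) * g i) = (\<Sum>i\<le>Suc M. real (M choose i) * g i)" by simp
  also have "\<dots> = g 0 + (\<Sum>i\<le>M. real (M choose Suc i) * g (Suc i))"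
    by (subst sum.atMost_Suc_shift) simp
  finally have *: "(\<Sum>i\<le>M. real (M choose i) * g i)
      = g 0 + (\<Sum>i\<le>M. real (M choose Suc i) * g (Suc i))" .
  have "(\<Sum>i\<le>Suc M. real (Suc M choose i) * g i)
      = g 0 + (\<Sum>i\<le>M. real (M choose i) * g (Suc i) + real (M choose Suc i) * g (Suc i))"
    by (subst sum.atMost_Suc_shift) (simp add: algebra_simps)
  then show ?thesis by (simp add: * sum.distrib distrib_left)
qed

text \<open>
  The expansion \<open>u\<^sup>k = \<Sum>\<^sub>i (M choose i) u\<^bsup>k + i\<^esup> (1 - u)\<^bsup>M - i\<^esup>\<close>, read for moments. Each step from \<open>M\<close> to
  \<open>M + 1\<close> splits every term by \<open>1 = (1 - u) + u\<close>.
\<close>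

lemma binomial_sum_fdiff:
  "(\<Sum>i\<le>M. real (M choose i) * ((-1) ^ (M - i) * (fdiff ^^ (M - i)) a (k + i))) = a k"
proof (induction M)
  case (Suc M)
  let ?d = "\<lambda>n j. (-1) ^ n * (fdiff ^^ n) a j"
  have "?d (Suc M - i) (k + i) + ?d (Suc M - Suc i) (k + Suc i) = ?d (M - i) (k + i)" if "i \<le> M" for i
    using that by (simp add: Suc_diff_le fdiff_def algebra_simps)
  then show ?case unfolding sum_choose_Suc using Suc.IH by simp
qed simp

text \<open>
  Moments with falling factorials in place of powers are reproduced exactly; only the passage from falling factorials
  to powers costs an error, which \<open>choose_ratio_approx\<close> bounds uniformly in \<open>j\<close>.
\<close>

lemma hausdorff_weight_falling_moment:
  assumes "k \<le> N"
  shows "(\<Sum>j\<le>N. hausdorff_weight a N j * (real (j choose k) / real (N choose k))) = a k"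
proof -
  have "(\<Sum>j\<le>N. hausdorff_weight a N j * (real (j choose k) / real (N choose k)))
      = (\<Sum>j\<in>{k..N}. hausdorff_weight a N j * (real (j choose k) / real (N choose k)))"
    by (intro sum.mono_neutral_right) auto
  also have "\<dots> = (\<Sum>j\<in>{k..N}. real ((N - k) choose (j - k)) * ((-1) ^ (N - j) * (fdiff ^^ (N - j)) a j))"
  proof (intro sum.cong refl)
    fix j assume j: "j \<in> {k..N}"
    then have "real (N choose j) * real (j choose k) = real (N choose k) * real ((N - k) choose (j - k))"
      by (metis atLeastAtMost_iff choose_mult of_nat_mult)
    moreover have "real (N choose k) \<noteq> 0" using assms by simp
    ultimately have *: "real (N choose j) * (real (j choose k) / real (N choose k))
        = real ((N - k) choose (j - k))" by (simp add: field_simps)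
    then show "hausdorff_weight a N j * (real (j choose k) / real (N choose k))
        = real ((N - k) choose (j - k)) * ((-1) ^ (N - j) * (fdiff ^^ (N - j)) a j)"
      unfolding hausdorff_weight_def *[symmetric] by (simp only: mult_ac)
  qed
  also have "\<dots> = (\<Sum>i\<le>N - k. real ((N - k) choose i) * ((-1) ^ (N - k - i) * (fdiff ^^ (N - k - i)) a (k + i)))"
    by (rule sum.reindex_bij_witness[of _ "\<lambda>i. k + i" "\<lambda>j. j - k"]) (use assms in auto)
  also have "\<dots> = a k" by (rule binomial_sum_fdiff)
  finally show ?thesis .
qed

lemma hausdorff_weight_sum: "(\<Sum>j\<le>N. hausdorff_weight a N j) = a 0"
  using hausdorff_weight_falling_moment[of 0 N a] by simp

text \<open>
  Both sides are products of \<open>k\<close> factors in \<open>[-1, 1]\<close>, namely \<open>j / N\<close> and \<open>(j - i) / (N - i)\<close> for \<open>i < k\<close>,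
  so their distance is at most the sum of the distances of the factors.
\<close>

lemma choose_ratio_approx:
  assumes jN: "j \<le> N" and kN: "2 * k < N"
  shows "\<bar>(real j / real N) ^ k - real (j choose k) / real (N choose k)\<bar> \<le> real k * (real k / (real N - real k))"
proof -
  have falling: "fact k * real (n choose k) = (\<Prod>i\<in>{0..<k}. real n - real i)" for n
    by (simp add: binomial_gbinomial gbinomial_mult_fact)
  have "real (j choose k) / real (N choose k) = (fact k * real (j choose k)) / (fact k * real (N choose k))"
    by simp
  also have "\<dots> = (\<Prod>i\<in>{0..<k}. (real j - real i) / (real N - real i))"
    unfolding falling prod_dividef ..
  finally have ratio: "real (j choose k) / real (N choose k)
      = (\<Prod>i\<in>{0..<k}. (real j - real i) / (real N - real i))" .
  have "norm ((\<Prod>i\<in>{0..<k}. real j / real N) - (\<Prod>i\<in>{0..<k}. (real j - real i) / (real N - real i)))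
      \<le> (\<Sum>i\<in>{0..<k}. norm (real j / real N - (real j - real i) / (real N - real i)))"
  proof (rule norm_prod_diff)
    fix i assume i: "i \<in> {0..<k}"
    show "norm (real j / real N) \<le> 1" using jN by (simp add: divide_le_eq)
    \<comment> \<open>For \<open>j < i\<close> the numerator is negative; \<open>2 * k < N\<close> keeps its modulus below \<open>N - i\<close>.\<close>
    have "\<bar>real j - real i\<bar> \<le> \<bar>real N - real i\<bar>" using i jN kN by (auto simp: abs_if)
    then show "norm ((real j - real i) / (real N - real i)) \<le> 1"
      by (auto simp: divide_le_eq)
  qed
  also have "\<dots> \<le> (\<Sum>i\<in>{0..<k}. real k / (real N - real k))"
  proof (rule sum_mono)
    fix i assume i: "i \<in> {0..<k}"
    have "real j / real N - (real j - real i) / (real N - real i)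
        = (real i / (real N - real i)) * ((real N - real j) / real N)"
      using i jN kN by (simp add: field_simps)
    moreover have "\<bar>(real N - real j) / real N\<bar> \<le> 1" using jN kN by (simp add: divide_le_eq)
    moreover have "\<bar>real i / (real N - real i)\<bar> \<le> real k / (real N - real k)"
      using i kN by (auto intro!: frac_le)
    ultimately show "norm (real j / real N - (real j - real i) / (real N - real i)) \<le> real k / (real N - real k)"
      using mult_mono[of "\<bar>real i / (real N - real i)\<bar>" "real k / (real N - real k)" "\<bar>(real N - real j) / real N\<bar>" 1]
        kN by (simp add: abs_mult)
  qed
  finally show ?thesis unfolding ratio by simp
qed

lemma hausdorff_moments_tendsto:
  assumes a: "completely_monotone_seq a"
  shows "(\<lambda>N. \<Sum>j\<le>N. hausdorff_weight a N j * (real j / real N) ^ k) \<longlonglongrightarrow> a k"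
proof -
  have "\<bar>(\<Sum>j\<le>N. hausdorff_weight a N j * (real j / real N) ^ k) - a k\<bar>
      \<le> a 0 * (real k * (real k / (real N - real k)))" if N: "2 * k < N" for N
  proof -
    have "(\<Sum>j\<le>N. hausdorff_weight a N j * (real j / real N) ^ k) - a k
      = (\<Sum>j\<le>N. hausdorff_weight a N j * ((real j / real N) ^ k - real (j choose k) / real (N choose k)))"
      using hausdorff_weight_falling_moment[of k N a] N
      by (simp add: right_diff_distrib sum_subtractf)
    also have "\<bar>\<dots>\<bar> \<le> (\<Sum>j\<le>N. hausdorff_weight a N j * (real k * (real k / (real N - real k))))"
    proof (rule order_trans[OF sum_abs], rule sum_mono)
      fix j assume "j \<in> {..N}"
      then show "\<bar>hausdorff_weight a N j * ((real j / real N) ^ k - real (j choose k) / real (N choose k))\<bar>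
          \<le> hausdorff_weight a N j * (real k * (real k / (real N - real k)))"
        using N hausdorff_weight_nonneg[OF a, of N j]
        by (simp only: abs_mult abs_of_nonneg) (intro mult_left_mono choose_ratio_approx, auto)
    qed
    also have "\<dots> = a 0 * (real k * (real k / (real N - real k)))"
      by (simp only: sum_distrib_right[symmetric] hausdorff_weight_sum)
    finally show ?thesis .
  qed
  then have "eventually (\<lambda>N. norm ((\<Sum>j\<le>N. hausdorff_weight a N j * (real j / real N) ^ k) - a k)
      \<le> a 0 * (real k * (real k / (real N - real k)))) sequentially"
    unfolding real_norm_def using eventually_gt_at_top[of "2 * k"] by (rule eventually_mono[rotated])
  moreover have "(\<lambda>N. a 0 * (real k * (real k / (real N - real k)))) \<longlonglongrightarrow> 0"
    by real_asymp
  ultimately have "(\<lambda>N. (\<Sum>j\<le>N. hausdorff_weight a N j * (real j / real N) ^ k) - a k) \<longlonglongrightarrow> 0"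
    by (rule Lim_null_comparison)
  then show ?thesis by (simp only: LIM_zero_iff)
qed

section \<open>From the samples back to the function\<close>

lemma higher_deriv_exp_sum:
  fixes l :: "'i \<Rightarrow> complex"
  shows "(deriv ^^ m) (\<lambda>z. \<Sum>j\<in>A. c j * exp ((z - e) * l j))
    = (\<lambda>z. \<Sum>j\<in>A. c j * l j ^ m * exp ((z - e) * l j))"
proof (induction m)
  case (Suc m)
  have "deriv (\<lambda>z. \<Sum>j\<in>A. c j * l j ^ m * exp ((z - e) * l j)) z
      = (\<Sum>j\<in>A. c j * l j ^ Suc m * exp ((z - e) * l j))" for z
    by (rule DERIV_imp_deriv) (auto intro!: derivative_eq_intros sum.cong)
  then show ?case by (simp add: Suc.IH)
qed simp

text \<open>
  Real derivatives of \<open>\<Psi>\<close> are read off from complex derivatives of its extension, for which locally uniform limits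
  may be differentiated termwise. Taking real parts avoids showing that these complex derivatives are real.
\<close>

lemma higher_deriv_real_restriction:
  assumes holF: "F holomorphic_on {z. 0 < Re z}"
    and F: "\<And>x. x > 0 \<Longrightarrow> F (of_real x) = of_real (\<Psi> x)" and x: "x > 0"
  shows "(deriv ^^ n) \<Psi> x = Re ((deriv ^^ n) F (of_real x))"
    and "(deriv ^^ n) \<Psi> field_differentiable at x"
proof -
  have step: "((deriv ^^ n) \<Psi> has_real_derivative Re ((deriv ^^ Suc n) F (of_real x))) (at x)"
    if eq: "\<And>x. x > 0 \<Longrightarrow> (deriv ^^ n) \<Psi> x = Re ((deriv ^^ n) F (of_real x))" and x: "x > 0" for n x
  proof -
    have "(deriv ^^ n) F holomorphic_on {z. 0 < Re z}"
      by (intro holomorphic_higher_deriv holF open_halfspace_Re_gt)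
    then have "((deriv ^^ n) F has_field_derivative (deriv ^^ Suc n) F (of_real x)) (at (of_real x))"
      using x by (auto intro!: holomorphic_derivI[OF _ open_halfspace_Re_gt])
    then have "((\<lambda>t. Re ((deriv ^^ n) F (of_real t))) has_real_derivative Re ((deriv ^^ Suc n) F (of_real x))) (at x)"
      by (intro has_field_derivative_Re has_vector_derivative_real_field)
    then show ?thesis
      by (rule has_field_derivative_transform_within_open[where S = "{0<..}"]) (use x eq in auto)
  qed
  have eq: "(deriv ^^ n) \<Psi> x = Re ((deriv ^^ n) F (of_real x))" if "x > 0" for n x
    using that
  proof (induction n arbitrary: x)
    case 0
    then show ?case by (simp add: F)
  next
    case (Suc n)
    from step[OF Suc.IH Suc.prems] show ?case by (simp add: DERIV_imp_deriv)
  qed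
  then show "(deriv ^^ n) \<Psi> x = Re ((deriv ^^ n) F (of_real x))" using x .
  show "(deriv ^^ n) \<Psi> field_differentiable at x"
    using step[OF eq x] by (auto simp: field_differentiable_def)
qed

text \<open>
  The exponential sums \<open>G N\<close> have derivatives of alternating sign because every exponent \<open>ln (j / N)\<close> is at most
  zero. They form a normal family, and the limit of a subsequence is identified with \<open>F\<close> by its values at \<open>e + k\<close>
  for \<open>k \<ge> 1\<close>. The point \<open>j = 0\<close> is left out of the sums, as \<open>0\<^bsup>z - e\<^esup>\<close> is not an exponential; its mass does
  not contribute to moments of positive order.
\<close>

lemma derivatives_alternate_beyond_sampling_point:
  assumes holF: "F holomorphic_on {z. 0 < Re z}"
    and F: "\<And>x. x > 0 \<Longrightarrow> F (of_real x) = of_real (\<Psi> x)"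
    and bounded: "bounded (F ` {z. e < Re z})"
    and e: "e > 0" and cm: "completely_monotone_seq (\<lambda>k. \<Psi> (e + real k))"
    and x: "x > e"
  shows "0 \<le> (-1) ^ m * Re ((deriv ^^ m) F (of_real x))"
proof -
  define a where "a = (\<lambda>k. \<Psi> (e + real k))"
  note a = cm[folded a_def]
  let ?S = "{z. e < Re z}"
  have open_S: "open ?S" by (rule open_halfspace_Re_gt)
  let ?l = "\<lambda>N j. ln (real j / real N)"
  define G where "G N z = (\<Sum>j=1..N. of_real (hausdorff_weight a N j) * exp ((z - of_real e) * of_real (?l N j)))"
    for N and z :: complex
  have l: "?l N j \<le> 0" if "j \<in> {1..N}" for j N
    using that by (simp add: ln_le_zero_iff)
  have holG: "G N holomorphic_on ?S" for N
    unfolding G_def by (intro holomorphic_intros)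
  have G_le: "norm (G N z) \<le> a 0" if z: "e < Re z" for N z
  proof -
    have "norm (G N z) \<le> (\<Sum>j=1..N. hausdorff_weight a N j)"
      unfolding G_def
    proof (rule sum_norm_le)
      fix j assume "j \<in> {1..N}"
      then have "exp ((Re z - e) * ?l N j) \<le> 1"
        using l z by (simp add: mult_nonneg_nonpos)
      then show "norm (of_real (hausdorff_weight a N j) * exp ((z - of_real e) * of_real (?l N j)))
          \<le> hausdorff_weight a N j"
        using hausdorff_weight_nonneg[OF a, of N j] by (simp add: norm_mult mult_left_le)
    qed
    also have "\<dots> \<le> (\<Sum>j\<le>N. hausdorff_weight a N j)"
      by (intro sum_mono2) (auto intro: hausdorff_weight_nonneg[OF a])
    finally show ?thesis by (simp add: hausdorff_weight_sum)
  qed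
  have G_nat: "G N (of_real e + of_nat k) = of_real (\<Sum>j\<le>N. hausdorff_weight a N j * (real j / real N) ^ k)"
    if k: "k \<ge> 1" for N k
  proof -
    have "exp (of_nat k * complex_of_real (?l N j)) = of_real ((real j / real N) ^ k)" if j: "j \<in> {1..N}" for j
    proof -
      have "exp (of_nat k * complex_of_real (?l N j)) = of_real (exp (real k * ?l N j))"
        by (simp add: exp_of_real[symmetric])
      also have "exp (real k * ?l N j) = (real j / real N) ^ k"
        using j by (subst exp_of_nat_mult) simp
      finally show ?thesis .
    qed
    then have "G N (of_real e + of_nat k) = of_real (\<Sum>j=1..N. hausdorff_weight a N j * (real j / real N) ^ k)"
      by (simp add: G_def)
    also have "(\<Sum>j=1..N. hausdorff_weight a N j * (real j / real N) ^ k)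
        = (\<Sum>j\<le>N. hausdorff_weight a N j * (real j / real N) ^ k)"
    proof (rule sum.mono_neutral_left)
      show "\<forall>j\<in>{..N} - {1..N}. hausdorff_weight a N j * (real j / real N) ^ k = 0"
      proof
        fix j assume "j \<in> {..N} - {1..N}"
        then have "j = 0" by auto
        then show "hausdorff_weight a N j * (real j / real N) ^ k = 0" using k by simp
      qed
    qed auto
    finally show ?thesis .
  qed
  define \<H> where "\<H> = {h. h holomorphic_on ?S \<and> (\<forall>z\<in>?S. norm (h z) \<le> a 0)}"
  have "range G \<subseteq> \<H>" using holG G_le by (auto simp: \<H>_def)
  moreover have "\<exists>B. \<forall>h\<in>\<H>. \<forall>z\<in>K. norm (h z) \<le> B" if "K \<subseteq> ?S" for K
    using that by (intro exI[of _ "a 0"]) (auto simp: \<H>_def)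
  ultimately obtain g r where holg: "g holomorphic_on ?S" and r: "strict_mono (r :: nat \<Rightarrow> nat)"
    and lim: "\<And>z. z \<in> ?S \<Longrightarrow> (\<lambda>n. G (r n) z) \<longlonglongrightarrow> g z"
    and ulim: "\<And>K. compact K \<Longrightarrow> K \<subseteq> ?S \<Longrightarrow> uniform_limit K (G \<circ> r) g sequentially"
    using Montel[OF open_S, of \<H> G] unfolding \<H>_def by (smt (verit, ccfv_threshold) mem_Collect_eq)
  have g_le: "norm (g z) \<le> a 0" if "e < Re z" for z
    using lim[of z] G_le[OF that] that
    by (intro Lim_norm_ubound[OF _ lim]) auto
  have g_nat: "g (of_real e + of_nat k) = of_real (a k)" if k: "k \<ge> 1" for k
  proof (rule LIMSEQ_unique)
    show "(\<lambda>n. G (r n) (of_real e + of_nat k)) \<longlonglongrightarrow> g (of_real e + of_nat k)"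
      using k by (intro lim) simp
    have "(\<lambda>n. \<Sum>j\<le>r n. hausdorff_weight a (r n) j * (real j / real (r n)) ^ k) \<longlonglongrightarrow> a k"
      using LIMSEQ_subseq_LIMSEQ[OF hausdorff_moments_tendsto[OF a] r] by (simp add: o_def)
    then show "(\<lambda>n. G (r n) (of_real e + of_nat k)) \<longlonglongrightarrow> of_real (a k)"
      unfolding G_nat[OF k] by (rule tendsto_of_real)
  qed
  obtain B where B: "\<And>z. e < Re z \<Longrightarrow> norm (F z) \<le> B"
    using bounded by (auto simp: bounded_iff)
  have Fg: "F w = g w" if w: "w \<in> ?S" for w
  proof -
    define h where "h z = F (z + of_real e) - g (z + of_real e)" for z
    have "h (w - of_real e) = 0"
    proof (rule bounded_half_plane_zero[where f = h])
      have shift: "(\<lambda>z. z + of_real e) holomorphic_on {z. 0 < Re z}" by (intro holomorphic_intros)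
      have "(F \<circ> (\<lambda>z. z + of_real e)) holomorphic_on {z. 0 < Re z}"
        using e by (intro holomorphic_on_compose_gen[OF shift holF]) auto
      moreover have "(g \<circ> (\<lambda>z. z + of_real e)) holomorphic_on {z. 0 < Re z}"
        by (intro holomorphic_on_compose_gen[OF shift holg]) auto
      ultimately show "h holomorphic_on {z. 0 < Re z}"
        unfolding h_def o_def by (rule holomorphic_on_diff)
      show "norm (h z) \<le> B + a 0" if "0 < Re z" for z
        unfolding h_def using that B[of "z + of_real e"] g_le[of "z + of_real e"]
        by (intro order_trans[OF norm_triangle_ineq4] add_mono) auto
      show "h (of_nat k) = 0" if "k \<ge> 1" for k
        using g_nat[OF that] F[of "e + real k"] e by (simp add: h_def a_def add.commute)
    qed (use w in simp)
    then show ?thesis by (simp add: h_def)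
  qed
  obtain \<delta> where \<delta>: "\<delta> > 0" "cball (of_real x) \<delta> \<subseteq> ?S"
    using open_contains_cball[THEN iffD1, OF open_S, rule_format, of "of_real x"] x by auto
  have "(\<lambda>n. (deriv ^^ m) ((G \<circ> r) n) (of_real x)) \<longlonglongrightarrow> (deriv ^^ m) g (of_real x)"
  proof (rule higher_deriv_complex_uniform_limit)
    show "uniform_limit (ball (of_real x) \<delta>) (G \<circ> r) g sequentially"
      using ulim[OF compact_cball \<delta>(2)] by (rule uniform_limit_on_subset) auto
    show "\<forall>\<^sub>F n in sequentially. (G \<circ> r) n holomorphic_on ball (of_real x) \<delta>"
    proof (intro always_eventually allI)
      have "ball (complex_of_real x) \<delta> \<subseteq> ?S" using \<delta>(2) ball_subset_cball by (rule subset_trans[rotated])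
      then show "(G \<circ> r) n holomorphic_on ball (of_real x) \<delta>" for n
        using holomorphic_on_subset[OF holG] by simp
    qed
  qed (use \<delta> in auto)
  moreover have "(deriv ^^ m) F (of_real x) = (deriv ^^ m) g (of_real x)"
  proof (rule higher_deriv_transform_within_open[where S = ?S])
    show "F holomorphic_on ?S" by (rule holomorphic_on_subset[OF holF]) (use e in auto)
  qed (use holg open_S Fg x in auto)
  ultimately have deriv_lim: "(\<lambda>n. (-1) ^ m * Re ((deriv ^^ m) (G (r n)) (of_real x)))
      \<longlonglongrightarrow> (-1) ^ m * Re ((deriv ^^ m) F (of_real x))"
    by (auto intro!: tendsto_intros)
  have "0 \<le> (-1) ^ m * Re ((deriv ^^ m) (G N) (of_real x))" for N
  proof -
    have "(deriv ^^ m) (G N) (of_real x)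
        = (\<Sum>j=1..N. of_real (hausdorff_weight a N j) * of_real (?l N j) ^ m * exp ((of_real x - of_real e) * of_real (?l N j)))"
      unfolding G_def higher_deriv_exp_sum ..
    also have "\<dots> = of_real (\<Sum>j=1..N. hausdorff_weight a N j * ?l N j ^ m * exp ((x - e) * ?l N j))"
      by (simp add: exp_of_real[symmetric])
    finally have "(-1) ^ m * Re ((deriv ^^ m) (G N) (of_real x))
        = (\<Sum>j=1..N. hausdorff_weight a N j * (- ?l N j) ^ m * exp ((x - e) * ?l N j))"
      by (simp add: sum_distrib_left power_minus[of "ln _"] mult_ac)
    also have "\<dots> \<ge> 0"
      using l by (intro sum_nonneg mult_nonneg_nonneg zero_le_power hausdorff_weight_nonneg[OF a]) auto
    finally show ?thesis .
  qed
  then show ?thesis by (intro LIMSEQ_le_const[OF deriv_lim]) blast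
qed

lemma completely_monotone_if_sampled:
  assumes \<epsilon>: "\<And>n. \<epsilon> n > 0" "\<epsilon> \<longlonglongrightarrow> 0"
    and ext: "\<And>n. bounded_holomorphic_extension \<Psi> (\<epsilon> n)"
    and cm: "\<And>n. completely_monotone_seq (\<lambda>k. \<Psi> (\<epsilon> n + real k))"
  shows "completely_monotone \<Psi>"
  unfolding completely_monotone_def
proof (intro conjI allI impI)
  fix m and x :: real assume x: "x > 0"
  have "eventually (\<lambda>n. \<epsilon> n < x) sequentially" using \<epsilon>(2) x by (rule order_tendstoD)
  then obtain n where n: "\<epsilon> n < x" by (auto simp: eventually_sequentially)
  obtain F where holF: "F holomorphic_on {z. 0 < Re z}"
    and F_real: "\<And>x. x > 0 \<Longrightarrow> F (of_real x) = of_real (\<Psi> x)"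
    and bdd: "bounded (F ` {z. \<epsilon> n < Re z})"
    using ext[of n] unfolding bounded_holomorphic_extension_def by blast
  show "(deriv ^^ m) \<Psi> field_differentiable at x"
    by (rule higher_deriv_real_restriction(2)[OF holF _ x]) (rule F_real)
  have "(deriv ^^ m) \<Psi> x = Re ((deriv ^^ m) F (of_real x))"
    by (rule higher_deriv_real_restriction(1)[OF holF _ x]) (rule F_real)
  moreover have "0 \<le> (-1) ^ m * Re ((deriv ^^ m) F (of_real x))"
    by (rule derivatives_alternate_beyond_sampling_point[OF holF _ bdd \<epsilon>(1) cm n]) (rule F_real)
  ultimately show "0 \<le> (-1) ^ m * (deriv ^^ m) \<Psi> x" by simp
qed

lemma sampled_if_completely_monotone:
  assumes cm: "completely_monotone \<Psi>" and e: "e > 0"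
  shows "bounded_holomorphic_extension \<Psi> e \<and> completely_monotone_seq (\<lambda>k. \<Psi> (e + real k)) \<and>
         minimal_seq (\<lambda>k. \<Psi> (e + real k))"
proof -
  note d = cm_jet_of_completely_monotone[OF cm]
  show ?thesis
    using cm_jet_bounded_holomorphic_extension[OF d e] completely_monotone_seq_of_jet[OF d e]
      minimal_seq_of_jet[OF d e]
    by simp
qed

theorem corollary1:
  fixes \<Psi> :: "real \<Rightarrow> real"
  assumes "\<Psi> \<in> borel_measurable (restrict_space borel {0<..})"
    and "\<And>x. x > 0 \<Longrightarrow> \<Psi> x \<ge> 0"
  shows "(completely_monotone \<Psi> \<longleftrightarrow>
            (\<exists>\<epsilon>::nat \<Rightarrow> real. (\<forall>n. \<epsilon> n > 0) \<and> \<epsilon> \<longlonglongrightarrow> 0 \<and>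
               (\<forall>n. bounded_holomorphic_extension \<Psi> (\<epsilon> n) \<and>
                    completely_monotone_seq (\<lambda>k. \<Psi> (\<epsilon> n + real k)) \<and>
                    minimal_seq (\<lambda>k. \<Psi> (\<epsilon> n + real k))))) \<and>
         (completely_monotone \<Psi> \<longleftrightarrow>
            (\<forall>\<epsilon>::nat \<Rightarrow> real. (\<forall>n. \<epsilon> n > 0) \<and> \<epsilon> \<longlonglongrightarrow> 0 \<longrightarrow>
               (\<forall>n. bounded_holomorphic_extension \<Psi> (\<epsilon> n) \<and>
                    completely_monotone_seq (\<lambda>k. \<Psi> (\<epsilon> n + real k)) \<and>
                    minimal_seq (\<lambda>k. \<Psi> (\<epsilon> n + real k)))))"
proof -
  let ?P = "\<lambda>e. bounded_holomorphic_extension \<Psi> e \<and>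
      completely_monotone_seq (\<lambda>k. \<Psi> (e + real k)) \<and> minimal_seq (\<lambda>k. \<Psi> (e + real k))"
  let ?null = "\<lambda>\<epsilon> :: nat \<Rightarrow> real. (\<forall>n. \<epsilon> n > 0) \<and> \<epsilon> \<longlonglongrightarrow> 0"
  have to_all: "\<forall>\<epsilon>. ?null \<epsilon> \<longrightarrow> (\<forall>n. ?P (\<epsilon> n))" if "completely_monotone \<Psi>"
    using sampled_if_completely_monotone[OF that] by simp
  have to_ex: "\<exists>\<epsilon>. ?null \<epsilon> \<and> (\<forall>n. ?P (\<epsilon> n))" if "\<forall>\<epsilon>. ?null \<epsilon> \<longrightarrow> (\<forall>n. ?P (\<epsilon> n))"
  proof -
    let ?s = "\<lambda>n. inverse (real (Suc n))"
    have null: "?null ?s" using LIMSEQ_inverse_real_of_nat by simp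
    show ?thesis by (rule exI[of _ ?s], rule conjI[OF null that[THEN spec, THEN mp, OF null]])
  qed
  have from_ex: "completely_monotone \<Psi>" if ex: "\<exists>\<epsilon>. ?null \<epsilon> \<and> (\<forall>n. ?P (\<epsilon> n))"
  proof -
    from ex obtain \<epsilon> where "?null \<epsilon> \<and> (\<forall>n. ?P (\<epsilon> n))" by (rule exE)
    then show ?thesis by (intro completely_monotone_if_sampled[of \<epsilon>]) simp_all
  qed
  have "completely_monotone \<Psi> \<longleftrightarrow> (\<exists>\<epsilon>. ?null \<epsilon> \<and> (\<forall>n. ?P (\<epsilon> n)))"
    by (rule iffI[OF to_ex[OF to_all] from_ex])
  moreover have "completely_monotone \<Psi> \<longleftrightarrow> (\<forall>\<epsilon>. ?null \<epsilon> \<longrightarrow> (\<forall>n. ?P (\<epsilon> n)))"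
    by (rule iffI[OF to_all from_ex[OF to_ex]])
  ultimately show ?thesis by (simp only: conj_assoc simp_thms)
qed

end
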